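(* Consider the RDAG model on a coloured DAG $(\mathcal{G},c)$ with compatible colouring $c$, and let $Y\in\mathbb{R}^{m\times n}$ be a sample matrix. For each $s\in c(I)$, let $P_{Y,s}$ be the orthogonal projection of $M_{Y,s}^{(0)}$ onto $\mathrm{span}\{M_{Y,s}^{(t)} : t\in\mathrm{prc}(s)\}$. If $P_{Y,s}=M_{Y,s}^{(0)}$ for some $s\in c(I)$, then no MLE given $Y$ exists. Otherwise, for any choice of coefficients $\lambda_{s,t}\in\mathbb{R}$ ($s\in c(I)$, $t\in\mathrm{prc}(s)$) with $$P_{Y,s}=\sum_{t\in\mathrm{prc}(s)}\lambda_{s,t}M_{Y,s}^{(t)}\quad\text{for all } s\in c(I),$$ and with $$\omega_{ss}:=\frac{1}{\alpha_s n}\,\big\|P_{Y,s}-M_{Y,s}^{(0)}\big\|^2\quad\text{for all } s\in c(I),$$ the matrix $\Psi=(\mathrm{id}-\Lambda)^{\mathsf T}\Omega^{-1}(\mathrm{id}-\Lambda)$ is an MLE given $Y$, where $\Lambda$ has entry $\lambda_{s,t}$ at every edge of colour $t\in\mathrm{prc}(s)$ (and zeros at non-edges) and $\Omega$ is the diagonal matrix with diagonal entry $\omega_{ss}$ at every vertex of colour $s$.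
   Context: $\mathcal{G}=(I,E)$ is a directed acyclic graph (DAG) with vertex set $I=[m]=\{1,\dots,m\}$ and edge set $E$ (no loops, no multiple edges); $j\to i$ denotes an edge from $j$ to $i$. Vertices are ordered so that $j\to i$ implies $j>i$. A coloured DAG $(\mathcal{G},c)$ is a DAG with a map $c: I\cup E\to \mathcal{C}$ to a set of colours; $c(i)$ is the colour of vertex $i$ and $c(ij)$ is the colour of the edge $j\to i$. The colouring $c$ is compatible if (i) vertex colours and edge colours are disjoint, and (ii) whenever edges $j\to i$ and $l\to k$ satisfy $c(ij)=c(kl)$, then $c(i)=c(k)$. The RDAG model on $(\mathcal{G},c)$ is the set of all matrices $\Psi=(\mathrm{id}-\Lambda)^{\mathsf T}\Omega^{-1}(\mathrm{id}-\Lambda)$, where $\Lambda\in\mathbb{R}^{m\times m}$ satisfies $\lambda_{ij}=0$ unless $j\to i$ in $\mathcal{G}$ and $\lambda_{ij}=\lambda_{kl}$ whenever edges $j\to i$ and $l\to k$ have the same colour, and $\Omega\in\mathbb{R}^{m\times m}$ is diagonal with positive diagonal entries satisfying $\omega_{ii}=\omega_{jj}$ whenever vertices $i,j$ have the same colour. For a sample matrix $Y\in\mathbb{R}^{m\times n}$ ($n\ge 1$; $Y^{(i)}\in\mathbb{R}^{1\times n}$ is the $i$th row), the log-likelihood is $\ell_Y(\Psi)=\log\det(\Psi)-\mathrm{tr}(\Psi S_Y)$ with $S_Y=\frac1n YY^{\mathsf T}$. An MLE given $Y$ is a maximiser of $\ell_Y$ over the model. For a vertex colour $s\in c(I)$,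 let $\alpha_s$ be the number of vertices of colour $s$, $\mathrm{prc}(s)=\{c(ij)\mid j\to i \text{ in }\mathcal{G},\ c(i)=s\}$, and $\beta_s=|\mathrm{prc}(s)|$; by compatibility each edge colour lies in $\mathrm{prc}(s)$ for exactly one $s$. Let $i_1<\dots<i_{\alpha_s}$ be the vertices of colour $s$. The augmented sample matrix $M_{Y,s}\in\mathbb{R}^{(\beta_s+1)\times\alpha_s n}$ has top row $M_{Y,s}^{(0)}=(Y^{(i_1)},\dots,Y^{(i_{\alpha_s})})$ and further rows $M_{Y,s}^{(t)}$ indexed by $t\in\mathrm{prc}(s)$, where $M_{Y,s}^{(t)}$ consists of $\alpha_s$ blocks of length $n$ with $k$th block $\sum_{j:\, j\to i_k,\ c(i_kj)=t} Y^{(j)}$ (zero if the sum is empty). *)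

theory Defs
  imports
    Complex_Main
    "Jordan_Normal_Form.VS_Connect"
    "Jordan_Normal_Form.Gauss_Jordan_Elimination"
begin

section \<open>Coloured DAGs\<close>

text \<open>
  The vertices are \<open>0, \<dots>, m - 1\<close>, matching the 0-based indices of the matrix type.
  A pair \<open>(j, i) \<in> E\<close> is an edge \<open>j \<rightarrow> i\<close>.  A colouring consists of \<open>cv\<close> on vertices and \<open>ce\<close> on
  edges, with one common type of colours; as in the usual \<open>c(ij)\<close>, the colour of \<open>j \<rightarrow> i\<close> is \<open>ce i j\<close>,
  target first.
\<close>

definition ordered_dag :: "nat \<Rightarrow> (nat \<times> nat) set \<Rightarrow> bool" where
  "ordered_dag m E \<longleftrightarrow> E \<subseteq> {..<m} \<times> {..<m} \<and> acyclic E \<and> (\<forall>(j, i) \<in> E. j > i)"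

definition compatible_colouring ::
  "nat \<Rightarrow> (nat \<times> nat) set \<Rightarrow> (nat \<Rightarrow> 'c) \<Rightarrow> (nat \<Rightarrow> nat \<Rightarrow> 'c) \<Rightarrow> bool" where
  "compatible_colouring m E cv ce \<longleftrightarrow>
     cv ` {..<m} \<inter> {ce i j | i j. (j, i) \<in> E} = {} \<and>
     (\<forall>i j k l. (j, i) \<in> E \<longrightarrow> (l, k) \<in> E \<longrightarrow> ce i j = ce k l \<longrightarrow> cv i = cv k)"

section \<open>The RDAG model and maximum likelihood estimates\<close>

definition concentration_mat :: "nat \<Rightarrow> real mat \<Rightarrow> real mat \<Rightarrow> real mat" where
  "concentration_mat m \<Lambda> \<Omega> =
     transpose_mat (1\<^sub>m m - \<Lambda>) * the (mat_inverse \<Omega>) * (1\<^sub>m m - \<Lambda>)"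

definition rdag_model ::
  "nat \<Rightarrow> (nat \<times> nat) set \<Rightarrow> (nat \<Rightarrow> 'c) \<Rightarrow> (nat \<Rightarrow> nat \<Rightarrow> 'c) \<Rightarrow> real mat set" where
  "rdag_model m E cv ce = {concentration_mat m \<Lambda> \<Omega> | \<Lambda> \<Omega>.
     \<Lambda> \<in> carrier_mat m m \<and>
     (\<forall>i<m. \<forall>j<m. (j, i) \<notin> E \<longrightarrow> \<Lambda> $$ (i, j) = 0) \<and>
     (\<forall>i j k l. (j, i) \<in> E \<longrightarrow> (l, k) \<in> E \<longrightarrow> ce i j = ce k l \<longrightarrow> \<Lambda> $$ (i, j) = \<Lambda> $$ (k, l)) \<and>
     \<Omega> \<in> carrier_mat m m \<and> diagonal_mat \<Omega> \<and>
     (\<forall>i<m. \<Omega> $$ (i, i) > 0) \<and>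
     (\<forall>i<m. \<forall>j<m. cv i = cv j \<longrightarrow> \<Omega> $$ (i, i) = \<Omega> $$ (j, j))}"

definition mat_trace :: "real mat \<Rightarrow> real" where
  "mat_trace A = (\<Sum>i<dim_row A. A $$ (i, i))"

definition sample_covariance :: "nat \<Rightarrow> real mat \<Rightarrow> real mat" where
  "sample_covariance n Y = (1 / real n) \<cdot>\<^sub>m (Y * transpose_mat Y)"

definition log_likelihood :: "nat \<Rightarrow> real mat \<Rightarrow> real mat \<Rightarrow> real" where
  "log_likelihood n Y \<Psi> = ln (det \<Psi>) - mat_trace (\<Psi> * sample_covariance n Y)"

definition is_MLE ::
  "nat \<Rightarrow> nat \<Rightarrow> (nat \<times> nat) set \<Rightarrow> (nat \<Rightarrow> 'c) \<Rightarrow> (nat \<Rightarrow> nat \<Rightarrow> 'c) \<Rightarrow> real mat \<Rightarrow> real mat \<Rightarrow> bool"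
where
  "is_MLE m n E cv ce Y \<Psi> \<longleftrightarrow>
     \<Psi> \<in> rdag_model m E cv ce \<and>
     (\<forall>\<Psi>' \<in> rdag_model m E cv ce. log_likelihood n Y \<Psi>' \<le> log_likelihood n Y \<Psi>)"

section \<open>Augmented sample matrices\<close>

definition vertices_of :: "nat \<Rightarrow> (nat \<Rightarrow> 'c) \<Rightarrow> 'c \<Rightarrow> nat list" where
  "vertices_of m cv s = sorted_list_of_set {i. i < m \<and> cv i = s}"

definition alpha :: "nat \<Rightarrow> (nat \<Rightarrow> 'c) \<Rightarrow> 'c \<Rightarrow> nat" where
  "alpha m cv s = card {i. i < m \<and> cv i = s}"

definition prc :: "(nat \<times> nat) set \<Rightarrow> (nat \<Rightarrow> 'c) \<Rightarrow> (nat \<Rightarrow> nat \<Rightarrow> 'c) \<Rightarrow> 'c \<Rightarrow> 'c set" where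
  "prc E cv ce s = {ce i j | i j. (j, i) \<in> E \<and> cv i = s}"

text \<open>
  The matrix \<open>M\<^bsub>Y,s\<^esub>\<close> is given by its top row and by its rows indexed by \<open>t \<in> prc s\<close>.  Each row
  is a vector of length \<open>\<alpha>\<^sub>s * n\<close> made of \<open>\<alpha>\<^sub>s\<close> blocks of length \<open>n\<close>: position \<open>p\<close> lies in block
  \<open>p div n\<close>, at place \<open>p mod n\<close>.
\<close>

definition aug_top :: "nat \<Rightarrow> nat \<Rightarrow> (nat \<Rightarrow> 'c) \<Rightarrow> real mat \<Rightarrow> 'c \<Rightarrow> real vec" where
  "aug_top m n cv Y s =
     vec (alpha m cv s * n) (\<lambda>p. Y $$ (vertices_of m cv s ! (p div n), p mod n))"

definition aug_row ::
  "nat \<Rightarrow> nat \<Rightarrow> (nat \<times> nat) set \<Rightarrow> (nat \<Rightarrow> 'c) \<Rightarrow> (nat \<Rightarrow> nat \<Rightarrow> 'c) \<Rightarrow> real mat \<Rightarrow> 'c \<Rightarrow> 'c \<Rightarrow> real vec"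
where
  "aug_row m n E cv ce Y s t =
     vec (alpha m cv s * n)
       (\<lambda>p. let i = vertices_of m cv s ! (p div n)
            in \<Sum>j \<in> {j. (j, i) \<in> E \<and> ce i j = t}. Y $$ (j, p mod n))"

section \<open>Orthogonal projection\<close>

abbreviation vec_span :: "nat \<Rightarrow> real vec set \<Rightarrow> real vec set" where
  "vec_span d S \<equiv> LinearCombinations.module.span class_ring (module_vec TYPE(real) d) S"

definition is_orth_proj :: "nat \<Rightarrow> real vec set \<Rightarrow> real vec \<Rightarrow> real vec \<Rightarrow> bool" where
  "is_orth_proj d S x p \<longleftrightarrow> p \<in> vec_span d S \<and> (\<forall>v \<in> vec_span d S. (x - p) \<bullet> v = 0)"

definition orth_proj :: "nat \<Rightarrow> real vec set \<Rightarrow> real vec \<Rightarrow> real vec" where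
  "orth_proj d S x = (THE p. is_orth_proj d S x p)"

lemma vec_span_carrier:
  assumes "S \<subseteq> carrier_vec d"
  shows "vec_span d S \<subseteq> carrier_vec d"
proof -
  interpret V: vec_space "TYPE(real)" d .
  show ?thesis using V.span_is_subset2 assms by simp
qed

lemma orth_to_span:
  assumes S: "S \<subseteq> carrier_vec d" and u: "u \<in> carrier_vec d"
    and o: "\<And>a. a \<in> S \<Longrightarrow> u \<bullet> a = 0" and v: "v \<in> vec_span d S"
  shows "u \<bullet> v = 0"
proof -
  interpret V: vec_space "TYPE(real)" d .
  have sub: "LinearCombinations.submodule class_ring {w \<in> carrier_vec d. u \<bullet> w = 0} (module_vec TYPE(real) d)"
    unfolding LinearCombinations.submodule_def
    using u V.module_axioms by (auto simp: scalar_prod_add_distrib)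
  have "vec_span d S \<subseteq> {w \<in> carrier_vec d. u \<bullet> w = 0}"
    by (rule V.span_is_subset[OF _ sub]) (use S o in auto)
  then show ?thesis using v by auto
qed

lemma orth_proj_exists:
  assumes "finite S" "S \<subseteq> carrier_vec d" "x \<in> carrier_vec d"
  shows "\<exists>p. is_orth_proj d S x p"
  using assms
proof (induction S arbitrary: x rule: finite_induct)
  interpret V: vec_space "TYPE(real)" d .
  case empty
  then show ?case
    by (intro exI[of _ "0\<^sub>v d"]) (auto simp: is_orth_proj_def V.span_empty)
next
  interpret V: vec_space "TYPE(real)" d .
  case (insert a S)
  have S: "S \<subseteq> carrier_vec d" and a: "a \<in> carrier_vec d" using insert.prems by auto
  have aS: "insert a S \<subseteq> carrier_vec d" using insert.prems by auto
  have mono: "vec_span d S \<subseteq> vec_span d (insert a S)"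
    by (rule V.span_is_monotone) auto
  have amem: "a \<in> vec_span d (insert a S)" using V.span_mem[of "insert a S" a] aS by auto
  obtain q where q: "is_orth_proj d S a q" using insert.IH[OF S a] by blast
  obtain r where r: "is_orth_proj d S x r" using insert.IH[OF S insert.prems(2)] by blast
  have qc: "q \<in> carrier_vec d" and rc: "r \<in> carrier_vec d"
    using q r vec_span_carrier[OF S] unfolding is_orth_proj_def by auto
  define b where "b = a - q"
  define k where "k = (if b \<bullet> b = 0 then 0 else (x \<bullet> b) / (b \<bullet> b))"
  have bc: "b \<in> carrier_vec d" using a qc b_def by simp
  have xc: "x \<in> carrier_vec d" using insert.prems by simp
  have bS: "b \<bullet> v = 0" if "v \<in> vec_span d S" for v using q that unfolding is_orth_proj_def b_def by auto
  have xS: "(x - r) \<bullet> v = 0" if "v \<in> vec_span d S" for v using r that unfolding is_orth_proj_def by auto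
  have qs: "q \<in> vec_span d S" and rs: "r \<in> vec_span d S" using q r unfolding is_orth_proj_def by auto
  have b0: "b = 0\<^sub>v d" if "b \<bullet> b = 0"
  proof -
    have "(\<Sum>i = 0..<d. b $ i * b $ i) = 0" using that bc by (simp add: scalar_prod_def)
    then have "\<forall>i \<in> {0..<d}. b $ i * b $ i = 0" by (subst (asm) sum_nonneg_eq_0_iff) auto
    then show ?thesis using bc by (intro eq_vecI) auto
  qed
  have bmem: "b \<in> vec_span d (insert a S)"
  proof -
    have "-1 \<cdot>\<^sub>v q \<in> vec_span d (insert a S)"
      by (rule V.smult_in_span[OF aS subsetD[OF mono qs]])
    then have "a + (-1 \<cdot>\<^sub>v q) \<in> vec_span d (insert a S)"
      using V.span_add1[of "insert a S" a "-1 \<cdot>\<^sub>v q"] amem aS by simp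
    moreover have "a + (-1 \<cdot>\<^sub>v q) = b" using a qc by (auto simp: b_def)
    ultimately show ?thesis by simp
  qed
  define p where "p = r + k \<cdot>\<^sub>v b"
  have pc: "p \<in> carrier_vec d" using rc bc by (simp add: p_def)
  have pm: "p \<in> vec_span d (insert a S)"
    unfolding p_def
    using V.span_add1[of "insert a S" r "k \<cdot>\<^sub>v b"] aS subsetD[OF mono rs] V.smult_in_span[OF aS bmem]
    by simp
  have dist: "(x - p) \<bullet> w = (x - r) \<bullet> w - k * (b \<bullet> w)" if w: "w \<in> carrier_vec d" for w
  proof -
    have "x - p = (x - r) - k \<cdot>\<^sub>v b" using xc rc bc by (auto simp: p_def)
    then show ?thesis using w xc rc bc by (simp add: minus_scalar_prod_distrib[of _ d])
  qed
  have oS: "(x - p) \<bullet> v = 0" if v: "v \<in> vec_span d S" for v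
    using dist[of v] v vec_span_carrier[OF S] xS[OF v] bS[OF v] by auto
  have ob: "(x - p) \<bullet> b = 0"
  proof (cases "b \<bullet> b = 0")
    case True
    then show ?thesis using b0 xc pc by simp
  next
    case False
    have "r \<bullet> b = 0" using bS[OF rs] comm_scalar_prod[OF rc bc] by simp
    then have "(x - r) \<bullet> b = x \<bullet> b" using xc rc bc by (simp add: minus_scalar_prod_distrib[of _ d])
    then show ?thesis using dist[OF bc] False by (simp add: k_def)
  qed
  have xp: "x - p \<in> carrier_vec d" using xc pc by simp
  have "a = b + q" using a qc by (intro eq_vecI) (auto simp: b_def)
  then have "(x - p) \<bullet> a = (x - p) \<bullet> (b + q)" by (rule arg_cong)
  also have "\<dots> = 0" using scalar_prod_add_distrib[OF xp bc qc] ob oS[OF qs] by simp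
  finally have oa: "(x - p) \<bullet> a = 0" .
  have "(x - p) \<bullet> v = 0" if v: "v \<in> vec_span d (insert a S)" for v
  proof (rule orth_to_span[OF aS xp _ v])
    fix w assume "w \<in> insert a S"
    then show "(x - p) \<bullet> w = 0" using oa oS V.span_mem[of S w] S by auto
  qed
  then show ?case using pm unfolding is_orth_proj_def by blast
qed

lemma orth_proj_unique:
  assumes S: "S \<subseteq> carrier_vec d" and x: "x \<in> carrier_vec d"
    and p: "is_orth_proj d S x p" and q: "is_orth_proj d S x q"
  shows "p = q"
proof -
  interpret V: vec_space "TYPE(real)" d .
  have pc: "p \<in> carrier_vec d" and qc: "q \<in> carrier_vec d"
    using p q vec_span_carrier[OF S] unfolding is_orth_proj_def by auto
  define w where "w = p - q"
  have wc: "w \<in> carrier_vec d" using pc qc by (simp add: w_def)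
  have ps: "p \<in> vec_span d S" and qs: "q \<in> vec_span d S" using p q by (auto simp: is_orth_proj_def)
  have "-1 \<cdot>\<^sub>v q \<in> vec_span d S" by (rule V.smult_in_span[OF S qs])
  then have "p + (-1 \<cdot>\<^sub>v q) \<in> vec_span d S"
    using V.span_add1[of S p "-1 \<cdot>\<^sub>v q"] ps S by simp
  moreover have "p + (-1 \<cdot>\<^sub>v q) = w" using pc qc by (auto simp: w_def)
  ultimately have ws: "w \<in> vec_span d S" by simp
  have "w = (x - q) - (x - p)" using pc qc x by (intro eq_vecI) (auto simp: w_def)
  then have "w \<bullet> w = ((x - q) - (x - p)) \<bullet> w" by (rule arg_cong)
  also have "\<dots> = (x - q) \<bullet> w - (x - p) \<bullet> w"
    by (rule minus_scalar_prod_distrib[of _ d]) (use pc qc x wc in auto)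
  also have "\<dots> = 0" using p q ws by (simp add: is_orth_proj_def)
  finally have "(\<Sum>i = 0..<d. w $ i * w $ i) = 0" using wc by (simp add: scalar_prod_def)
  then have "\<forall>i \<in> {0..<d}. w $ i * w $ i = 0" by (subst (asm) sum_nonneg_eq_0_iff) auto
  then have "\<forall>i<d. p $ i = q $ i" using pc qc by (auto simp: w_def)
  then show ?thesis using pc qc by (intro eq_vecI) auto
qed

lemma orth_proj_is_orth_proj:
  assumes "finite S" "S \<subseteq> carrier_vec d" "x \<in> carrier_vec d"
  shows "is_orth_proj d S x (orth_proj d S x)"
proof -
  obtain p where p: "is_orth_proj d S x p" using orth_proj_exists[OF assms] by blast
  show ?thesis
    unfolding orth_proj_def
    by (rule theI[of "is_orth_proj d S x" p, OF p]) (rule orth_proj_unique[OF assms(2,3) _ p])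
qed

section \<open>The projection and the estimate\<close>

definition proj_top ::
  "nat \<Rightarrow> nat \<Rightarrow> (nat \<times> nat) set \<Rightarrow> (nat \<Rightarrow> 'c) \<Rightarrow> (nat \<Rightarrow> nat \<Rightarrow> 'c) \<Rightarrow> real mat \<Rightarrow> 'c \<Rightarrow> real vec"
where
  "proj_top m n E cv ce Y s =
     orth_proj (alpha m cv s * n) (aug_row m n E cv ce Y s ` prc E cv ce s) (aug_top m n cv Y s)"

definition omega_hat ::
  "nat \<Rightarrow> nat \<Rightarrow> (nat \<times> nat) set \<Rightarrow> (nat \<Rightarrow> 'c) \<Rightarrow> (nat \<Rightarrow> nat \<Rightarrow> 'c) \<Rightarrow> real mat \<Rightarrow> 'c \<Rightarrow> real"
where
  "omega_hat m n E cv ce Y s =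
     (let r = proj_top m n E cv ce Y s - aug_top m n cv Y s
      in 1 / real (alpha m cv s * n) * (r \<bullet> r))"

definition coeff_mat ::
  "nat \<Rightarrow> (nat \<times> nat) set \<Rightarrow> (nat \<Rightarrow> 'c) \<Rightarrow> (nat \<Rightarrow> nat \<Rightarrow> 'c) \<Rightarrow> ('c \<Rightarrow> 'c \<Rightarrow> real) \<Rightarrow> real mat" where
  "coeff_mat m E cv ce lam =
     mat m m (\<lambda>(i, j). if (j, i) \<in> E then lam (cv i) (ce i j) else 0)"

definition variance_mat :: "nat \<Rightarrow> (nat \<Rightarrow> 'c) \<Rightarrow> ('c \<Rightarrow> real) \<Rightarrow> real mat" where
  "variance_mat m cv om = mat_diag m (\<lambda>i. om (cv i))"

end

theory Submission
  imports Defs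
begin

text \<open>
  Since every edge decreases the vertex index, \<open>1 - \<Lambda>\<close> is upper unitriangular. Hence the
  determinant of \<open>\<Psi> = (1 - \<Lambda>)\<^sup>T \<Omega>\<inverse> (1 - \<Lambda>)\<close> depends on \<open>\<Omega>\<close> only, and the trace term splits into
  the squared norms of the rows of \<open>(1 - \<Lambda>) Y\<close>.  Grouping the vertices by colour gives
  (\<open>log_likelihood_rdag\<close>)
  \<open>\<ell>\<^sub>Y(\<Psi>) = \<Sum>\<^sub>s (- \<alpha>\<^sub>s ln \<omega>\<^sub>s - R\<^sub>s(\<lambda>\<^sub>s) / (n \<omega>\<^sub>s))\<close>,
  where \<open>R\<^sub>s\<close>, called \<open>rss\<close> below, is the squared distance of the top row of \<open>M\<^bsub>Y,s\<^esub>\<close> to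
  the combination of its other rows with coefficients \<open>\<lambda>\<^sub>s\<close> (\<open>norm_residual_eq_rss\<close>).
  By \<open>rdag_model_parametrisation\<close>, the coefficients and the positive variances of the different
  vertex colours can be chosen independently, so each summand can be treated on its own.

  If the top row is its own projection for some colour \<open>s\<close>, then it is a combination of the other
  rows, so \<open>R\<^sub>s\<close> attains \<open>0\<close>.  Given any point of the model, passing to such coefficients for \<open>s\<close>
  and halving \<open>\<omega>\<^sub>s\<close> strictly increases the likelihood, so there is no maximiser.

  Otherwise, coefficients of the projection minimise \<open>R\<^sub>s\<close> (\<open>orth_proj_minimises_distance\<close>) with
  a positive minimum \<open>\<alpha>\<^sub>s n \<omega>\<^sub>s\<close>, and this \<open>\<omega>\<^sub>s\<close> maximises the summand because
  \<open>ln x \<le> x - 1\<close> (\<open>gaussian_summand_le\<close>).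
\<close>

section \<open>Linear algebra\<close>

lemma mat_trace_mult_commute:
  assumes A: "A \<in> carrier_mat p q" and B: "B \<in> carrier_mat q p"
  shows "mat_trace (A * B) = mat_trace (B * A)"
proof -
  have "mat_trace (A * B) = (\<Sum>i<p. \<Sum>k<q. A $$ (i, k) * B $$ (k, i))"
    using A B by (simp add: mat_trace_def scalar_prod_def atLeast0LessThan)
  also have "\<dots> = (\<Sum>k<q. \<Sum>i<p. B $$ (k, i) * A $$ (i, k))"
    by (subst sum.swap) (simp add: mult.commute)
  also have "\<dots> = mat_trace (B * A)"
    using A B by (simp add: mat_trace_def scalar_prod_def atLeast0LessThan)
  finally show ?thesis .
qed

lemma mat_inverse_mat_diag:
  fixes d :: "nat \<Rightarrow> 'a :: field"
  assumes "\<And>i. i < m \<Longrightarrow> d i \<noteq> 0"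
  shows "the (mat_inverse (mat_diag m d)) = mat_diag m (\<lambda>i. inverse (d i))"
proof -
  let ?D = "mat_diag m d" and ?D' = "mat_diag m (\<lambda>i. inverse (d i))"
  have r: "?D * ?D' = 1\<^sub>m m" and l: "?D' * ?D = 1\<^sub>m m"
    using assms unfolding mat_diag_diag by (auto simp: mat_diag_def)
  have "?D \<in> Units (ring_mat TYPE('a) m ())"
    using r l by (auto simp: Units_def ring_mat_def intro!: bexI[of _ ?D'])
  then obtain B where B: "mat_inverse ?D = Some B"
    using mat_inverse(1)[of ?D m "()"] by (cases "mat_inverse ?D") auto
  then have "?D * B = 1\<^sub>m m" and Bc: "B \<in> carrier_mat m m"
    using mat_inverse(2)[of ?D m B] by auto
  then have "?D' * (?D * B) = ?D'" by (simp add: right_mult_one_mat[OF mat_diag_dim])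
  then have "B = ?D'"
    using l Bc by (simp flip: assoc_mult_mat[of ?D' m m ?D m B m])
  then show ?thesis using B by simp
qed

lemma scalar_prod_self_nonneg: "0 \<le> (v :: real vec) \<bullet> v"
  by (simp add: scalar_prod_def sum_nonneg)

lemma scalar_prod_diff_self_pos:
  fixes v w :: "real vec"
  assumes "dim_vec v = dim_vec w" and "v \<noteq> w"
  shows "0 < (v - w) \<bullet> (v - w)"
proof -
  obtain i where i: "i < dim_vec w" "v $ i \<noteq> w $ i" using assms by (meson eq_vecI)
  have "0 < (v $ i - w $ i)\<^sup>2" using i by simp
  then show ?thesis
    unfolding scalar_prod_def using i by (intro sum_pos2[of _ i]) (auto simp: power2_eq_square)
qed

lemma orth_proj_minimises_distance:
  assumes S: "S \<subseteq> carrier_vec d" and x: "x \<in> carrier_vec d"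
    and p: "is_orth_proj d S x p" and v: "v \<in> vec_span d S"
  shows "(p - x) \<bullet> (p - x) \<le> (v - x) \<bullet> (v - x)"
proof -
  have ps: "p \<in> vec_span d S" using p by (simp add: is_orth_proj_def)
  have pc: "p \<in> carrier_vec d" and vc: "v \<in> carrier_vec d"
    using ps v vec_span_carrier[OF S] by auto
  define u w where "u = x - p" and "w = v - p"
  have uc: "u \<in> carrier_vec d" and wc: "w \<in> carrier_vec d"
    using x pc vc by (auto simp: u_def w_def)
  have "u \<bullet> v = 0" "u \<bullet> p = 0" using p ps v by (auto simp: is_orth_proj_def u_def)
  then have "u \<bullet> w = 0"
    using uc pc vc by (simp add: w_def scalar_prod_minus_distrib[of _ d])
  moreover have "w \<bullet> u = u \<bullet> w" by (rule comm_scalar_prod[OF wc uc])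
  moreover have "v - x = w - u" using x pc vc by (intro eq_vecI) (auto simp: u_def w_def)
  ultimately have "(v - x) \<bullet> (v - x) = w \<bullet> w + u \<bullet> u"
    using uc wc by (simp add: scalar_prod_minus_distrib[of _ d] minus_scalar_prod_distrib[of _ d])
  moreover have "(p - x) \<bullet> (p - x) = u \<bullet> u"
    using x pc by (simp add: u_def scalar_prod_def power2_eq_square[symmetric] power2_commute)
  ultimately show ?thesis using scalar_prod_self_nonneg[of w] by simp
qed

lemma finsum_vec_eq_vec:
  assumes "finite T" and "\<And>t. t \<in> T \<Longrightarrow> f t \<in> carrier_vec d"
  shows "finsum_vec TYPE(real) d f T = vec d (\<lambda>p. \<Sum>t\<in>T. f t $ p)"
proof (rule eq_vecI)
  have "finsum_vec TYPE(real) d f T \<in> carrier_vec d"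
    by (rule finsum_vec_closed) (use assms in auto)
  then show "dim_vec (finsum_vec TYPE(real) d f T) = dim_vec (vec d (\<lambda>p. \<Sum>t\<in>T. f t $ p))" by simp
qed (use assms in \<open>auto intro!: index_finsum_vec\<close>)

text \<open>
  As \<open>f\<close> need not be injective on \<open>T\<close>, this is not the definition of the span, whose linear
  combinations are indexed by the set of vectors itself.
\<close>

lemma vec_span_image:
  assumes T: "finite T" and f: "\<And>t. t \<in> T \<Longrightarrow> f t \<in> carrier_vec d"
  shows "vec_span d (f ` T) = range (\<lambda>c. finsum_vec TYPE(real) d (\<lambda>t. c t \<cdot>\<^sub>v f t) T)"
    (is "_ = range ?F")
proof -
  interpret V: vec_space "TYPE(real)" d .
  have fT: "f ` T \<subseteq> carrier_vec d" using f by auto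
  have F: "?F c = vec d (\<lambda>p. \<Sum>t\<in>T. c t * f t $ p)" for c
    using f by (subst finsum_vec_eq_vec[OF T]) (fastforce intro!: eq_vecI sum.cong)+
  have F_add: "?F a + ?F b = ?F (\<lambda>t. a t + b t)" for a b
    unfolding F by (auto intro!: eq_vecI simp: sum.distrib algebra_simps)
  have F_smult: "k \<cdot>\<^sub>v ?F a = ?F (\<lambda>t. k * a t)" for k a
    unfolding F by (auto intro!: eq_vecI simp: sum_distrib_left mult.assoc)
  have F_zero: "0\<^sub>v d = ?F (\<lambda>_. 0)" unfolding F by auto
  have F_unit: "f t = ?F (\<lambda>t'. if t' = t then 1 else 0)" if "t \<in> T" for t
  proof -
    have "(\<Sum>t'\<in>T. (if t' = t then 1 else 0) * f t' $ p) = f t $ p" for p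
      using that T sum.delta[of T t "\<lambda>t'. f t' $ p"] by (simp add: if_distrib[of "\<lambda>k. k * _"] cong: if_cong)
    then show ?thesis unfolding F using f[OF that] by (intro eq_vecI) auto
  qed
  have "?F c \<in> vec_span d (f ` T)" for c
    using T f
  proof (induction T rule: finite_induct)
    case empty
    then show ?case by (simp add: V.span_empty finsum_vec_empty)
  next
    case (insert t T)
    have ins: "f ` insert t T \<subseteq> carrier_vec d" using insert.prems by auto
    have "f t \<in> vec_span d (f ` insert t T)" using V.span_mem[of "f ` insert t T"] ins by auto
    then have "c t \<cdot>\<^sub>v f t \<in> vec_span d (f ` insert t T)" by (rule V.smult_in_span[OF ins])
    moreover have "vec_span d (f ` T) \<subseteq> vec_span d (f ` insert t T)"
      by (rule V.span_is_monotone) auto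
    ultimately show ?case
      using V.span_add1[of "f ` insert t T" "c t \<cdot>\<^sub>v f t"
          "finsum_vec TYPE(real) d (\<lambda>t. c t \<cdot>\<^sub>v f t) T"] ins insert
      by (subst finsum_vec_insert) auto
  qed
  moreover have "LinearCombinations.submodule class_ring (range ?F) (module_vec TYPE(real) d)"
    unfolding LinearCombinations.submodule_def
  proof (intro conjI)
    show "Module.module class_ring (module_vec TYPE(real) d)" by (rule V.module_axioms)
    show "range ?F \<subseteq> carrier V.V" unfolding F by auto
    show "\<zero>\<^bsub>V.V\<^esub> \<in> range ?F" using F_zero by auto
  qed (use F_add F_smult in auto)
  then have "vec_span d (f ` T) \<subseteq> range ?F"
  proof (rule V.span_is_subset[rotated], intro image_subsetI)
    show "f t \<in> range ?F" if "t \<in> T" for t by (subst F_unit[OF that]) (rule rangeI)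
  qed
  ultimately show ?thesis by blast
qed

section \<open>The log-likelihood as a sum over vertices\<close>

text \<open>
  By cyclicity of the trace, \<open>tr (B\<^sup>T D B Y Y\<^sup>T) = tr (D (B Y) (B Y)\<^sup>T)\<close> with \<open>B = 1 - \<Lambda>\<close> and
  \<open>D = \<Omega>\<inverse>\<close>.
\<close>

lemma log_likelihood_unitriangular:
  assumes L: "\<Lambda> \<in> carrier_mat m m"
    and ut: "\<And>i j. i < m \<Longrightarrow> j \<le> i \<Longrightarrow> \<Lambda> $$ (i, j) = 0"
    and d: "\<And>i. i < m \<Longrightarrow> d i > 0"
    and Y: "Y \<in> carrier_mat m n"
  shows "log_likelihood n Y (concentration_mat m \<Lambda> (mat_diag m d)) =
    (\<Sum>i<m. - ln (d i) - (\<Sum>q<n. (((1\<^sub>m m - \<Lambda>) * Y) $$ (i, q))\<^sup>2) / (real n * d i))"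
proof -
  define B where "B = 1\<^sub>m m - \<Lambda>"
  define D where "D = mat_diag m (\<lambda>i. inverse (d i))"
  define W where "W = B * Y"
  have B: "B \<in> carrier_mat m m" and D: "D \<in> carrier_mat m m" and W: "W \<in> carrier_mat m n"
    using L Y by (auto simp: B_def D_def W_def)
  have Psi: "concentration_mat m \<Lambda> (mat_diag m d) = transpose_mat B * D * B"
    using d mat_inverse_mat_diag[of m d]
    by (force simp: concentration_mat_def B_def D_def)
  have "upper_triangular B"
    using L ut by (auto simp: upper_triangular_def B_def)
  then have detB: "det B = 1"
    using B L ut by (simp add: det_upper_triangular prod_list_diag_prod B_def)
  have "upper_triangular D" by (auto simp: upper_triangular_def D_def mat_diag_def)
  then have detD: "det D = (\<Prod>i<m. inverse (d i))"
    using D by (simp add: det_upper_triangular prod_list_diag_prod atLeast0LessThan)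
      (simp add: D_def mat_diag_def)
  have "det (transpose_mat B * D * B) = (\<Prod>i<m. inverse (d i))"
    using B D detB detD by (simp add: det_mult[of _ m] det_transpose[of _ m])
  then have "ln (det (transpose_mat B * D * B)) = ln (\<Prod>i<m. inverse (d i))"
    by (rule arg_cong)
  also have "\<dots> = (\<Sum>i<m. - ln (d i))"
    using d by (subst ln_prod) (auto simp: ln_inverse dest: less_imp_neq[THEN not_sym])
  finally have "ln (det (transpose_mat B * D * B)) = (\<Sum>i<m. - ln (d i))" .
  moreover have "mat_trace (transpose_mat B * D * B * sample_covariance n Y) =
    (\<Sum>i<m. (\<Sum>q<n. (W $$ (i, q))\<^sup>2) / (real n * d i))"
  proof -
    have "transpose_mat B * D * B * sample_covariance n Y =
        (1 / real n) \<cdot>\<^sub>m (transpose_mat B * (D * B * (Y * transpose_mat Y)))"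
      using B D Y by (simp add: sample_covariance_def mult_smult_distrib[of _ m m _ m]
          assoc_mult_mat[of _ m m _ m _ m])
    moreover have "mat_trace (transpose_mat B * (D * B * (Y * transpose_mat Y))) =
        mat_trace (D * B * (Y * transpose_mat Y) * transpose_mat B)"
      by (rule mat_trace_mult_commute[of _ m m]) (use B D Y in auto)
    moreover have "D * B * (Y * transpose_mat Y) * transpose_mat B = D * (W * transpose_mat W)"
      using B D Y unfolding W_def transpose_mult[OF B Y]
      by (simp add: assoc_mult_mat[of _ m m _ m _ m] assoc_mult_mat[of _ m m _ n _ m]
          assoc_mult_mat[of _ m n _ m _ m])
    moreover have "mat_trace (D * (W * transpose_mat W)) =
        (\<Sum>i<m. inverse (d i) * (\<Sum>q<n. (W $$ (i, q))\<^sup>2))"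
      using W unfolding D_def
      by (subst mat_diag_mult_left[of _ m m])
        (auto simp: mat_trace_def scalar_prod_def atLeast0LessThan power2_eq_square)
    moreover have "mat_trace (k \<cdot>\<^sub>m A) = k * mat_trace A" if "A \<in> carrier_mat m m" for k A
      using that by (simp add: mat_trace_def sum_distrib_left)
    moreover have "transpose_mat B * (D * B * (Y * transpose_mat Y)) \<in> carrier_mat m m"
      using B D Y by (intro mult_carrier_mat[of _ m m _ m] mult_carrier_mat[of _ m n _ m]) auto
    ultimately have "mat_trace (transpose_mat B * D * B * sample_covariance n Y) =
        1 / real n * (\<Sum>i<m. inverse (d i) * (\<Sum>q<n. (W $$ (i, q))\<^sup>2))"
      by simp
    also have "\<dots> = (\<Sum>i<m. (\<Sum>q<n. (W $$ (i, q))\<^sup>2) / (real n * d i))"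
      unfolding sum_distrib_left[of "1 / real n"] by (intro sum.cong) (auto simp: field_simps)
    finally show ?thesis .
  qed
  ultimately show ?thesis
    unfolding log_likelihood_def Psi W_def B_def by (simp add: sum_subtractf)
qed


section \<open>Residual sums of squares\<close>

text \<open>
  Given coefficients \<open>c t\<close> for the edge colours \<open>t\<close>, this is the sum, over the vertices \<open>i\<close> of
  colour \<open>s\<close> and over all samples, of the squared errors of the linear prediction of
  \<open>Y\<^sup>(\<^sup>i\<^sup>)\<close> from the parents of \<open>i\<close>.
\<close>

definition rss ::
  "nat \<Rightarrow> nat \<Rightarrow> (nat \<times> nat) set \<Rightarrow> (nat \<Rightarrow> 'c) \<Rightarrow> (nat \<Rightarrow> nat \<Rightarrow> 'c) \<Rightarrow> real mat \<Rightarrow> 'c \<Rightarrow>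
     ('c \<Rightarrow> real) \<Rightarrow> real"
where
  "rss m n E cv ce Y s c =
     (\<Sum>i | i < m \<and> cv i = s. \<Sum>q<n.
        (Y $$ (i, q) - (\<Sum>j | (j, i) \<in> E. c (ce i j) * Y $$ (j, q)))\<^sup>2)"

lemma rss_nonneg: "0 \<le> rss m n E cv ce Y s c"
  unfolding rss_def by (intro sum_nonneg) auto

lemma finite_prc: "finite E \<Longrightarrow> finite (prc E cv ce s)"
  by (rule finite_subset[of _ "(\<lambda>(j, i). ce i j) ` E"]) (auto simp: prc_def)

lemma aug_row_combination_entry:
  assumes E: "finite E" and p: "p < alpha m cv s * n"
    and i: "i = vertices_of m cv s ! (p div n)" and s: "cv i = s"
  shows "finsum_vec TYPE(real) (alpha m cv s * n)
           (\<lambda>t. c t \<cdot>\<^sub>v aug_row m n E cv ce Y s t) (prc E cv ce s) $ p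
         = (\<Sum>j | (j, i) \<in> E. c (ce i j) * Y $$ (j, p mod n))"
proof -
  have fin: "finite {j. (j, i) \<in> E}"
    by (rule finite_subset[of _ "fst ` E"]) (use E in force)+
  have "finsum_vec TYPE(real) (alpha m cv s * n)
           (\<lambda>t. c t \<cdot>\<^sub>v aug_row m n E cv ce Y s t) (prc E cv ce s) $ p
      = (\<Sum>t\<in>prc E cv ce s. \<Sum>j | (j, i) \<in> E \<and> ce i j = t. c t * Y $$ (j, p mod n))"
    using finite_prc[OF E] p
    by (subst index_finsum_vec) (auto simp: aug_row_def i Let_def sum_distrib_left)
  also have "\<dots> = (\<Sum>t\<in>prc E cv ce s. \<Sum>j \<in> {j \<in> {j. (j, i) \<in> E}. ce i j = t}.
      c (ce i j) * Y $$ (j, p mod n))"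
    by (intro sum.cong) auto
  also have "\<dots> = (\<Sum>j | (j, i) \<in> E. c (ce i j) * Y $$ (j, p mod n))"
    by (rule sum.group[OF fin finite_prc[OF E]]) (use s in \<open>auto simp: prc_def\<close>)
  finally show ?thesis .
qed

lemma vertices_of_bij_betw:
  "bij_betw (\<lambda>k. vertices_of m cv s ! k) {..<alpha m cv s} {i. i < m \<and> cv i = s}"
  unfolding vertices_of_def alpha_def
  by (rule bij_betw_nth) (auto simp: sorted_list_of_set.sorted_key_list_of_set_unique)

text \<open>
  The residual sum of squares is the squared norm of the difference between \<open>M\<^bsub>Y,s\<^esub>\<^sup>(\<^sup>0\<^sup>)\<close> and the
  corresponding combination of the other rows: position \<open>k * n + q\<close> of these vectors belongs to
  sample \<open>q\<close> at the \<open>k\<close>-th vertex of colour \<open>s\<close>.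
\<close>

lemma norm_residual_eq_rss:
  assumes E: "finite E"
    and r: "r = finsum_vec TYPE(real) (alpha m cv s * n)
                  (\<lambda>t. c t \<cdot>\<^sub>v aug_row m n E cv ce Y s t) (prc E cv ce s) - aug_top m n cv Y s"
  shows "r \<bullet> r = rss m n E cv ce Y s c"
proof -
  define a where "a = alpha m cv s"
  define v where "v k = vertices_of m cv s ! k" for k
  define g where "g i q = (Y $$ (i, q) - (\<Sum>j | (j, i) \<in> E. c (ce i j) * Y $$ (j, q)))\<^sup>2" for i q
  have bij: "bij_betw v {..<a} {i. i < m \<and> cv i = s}"
    unfolding v_def a_def by (rule vertices_of_bij_betw)
  have dim: "dim_vec r = a * n" by (simp add: r aug_top_def a_def)
  have entry: "r $ p * r $ p = g (v (p div n)) (p mod n)" if p: "p < a * n" for p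
  proof -
    have "p div n < a" using p by (simp add: less_mult_imp_div_less)
    then have "cv (v (p div n)) = s" using bij_betwE[OF bij] by blast
    from aug_row_combination_entry[of E p m cv s n, OF E _ _ this, of c ce Y] p
    show ?thesis
      by (simp add: r a_def v_def g_def aug_top_def power2_eq_square[symmetric] power2_commute)
  qed
  have "r \<bullet> r = (\<Sum>p<a * n. g (v (p div n)) (p mod n))"
    unfolding scalar_prod_def dim atLeast0LessThan by (intro sum.cong) (auto simp: entry)
  also have "\<dots> = (\<Sum>k<a. \<Sum>p\<in>{k * n..<k * n + n}. g (v (p div n)) (p mod n))"
    by (rule sum.nat_group[symmetric])
  also have "\<dots> = (\<Sum>k<a. \<Sum>q<n. g (v k) q)"
  proof (rule sum.cong[OF refl])
    fix k
    have "(\<Sum>p\<in>{k * n..<k * n + n}. g (v (p div n)) (p mod n))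
        = (\<Sum>q = 0..<n. g (v ((q + k * n) div n)) ((q + k * n) mod n))"
      using sum.shift_bounds_nat_ivl[of "\<lambda>p. g (v (p div n)) (p mod n)" 0 "k * n" n]
      by (simp add: add.commute)
    also have "\<dots> = (\<Sum>q<n. g (v k) q)" by (intro sum.cong) auto
    finally show "(\<Sum>p\<in>{k * n..<k * n + n}. g (v (p div n)) (p mod n)) = (\<Sum>q<n. g (v k) q)" .
  qed
  also have "\<dots> = (\<Sum>i | i < m \<and> cv i = s. \<Sum>q<n. g i q)"
    using sum.reindex_bij_betw[OF bij, of "\<lambda>i. \<Sum>q<n. g i q"] .
  finally show ?thesis by (simp add: rss_def g_def)
qed

section \<open>The RDAG model\<close>

text \<open>
  Compatibility is what allows the coefficient of an edge colour to depend on the vertex colour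
  of the target as well: edges of equal colour have targets of equal colour.  It is therefore the
  reason why the coefficients \<open>lam s\<close> can be varied separately for each \<open>s\<close>.
\<close>

lemma rdag_model_parametrisation:
  assumes dag: "ordered_dag m E" and comp: "compatible_colouring m E cv ce"
  shows "rdag_model m E cv ce =
    {concentration_mat m (coeff_mat m E cv ce lam) (variance_mat m cv om) | lam om.
       \<forall>s \<in> cv ` {..<m}. om s > 0}" (is "_ = ?R")
proof
  have Em: "i < m" "j < m" if "(j, i) \<in> E" for i j using dag that by (auto simp: ordered_dag_def)
  show "rdag_model m E cv ce \<subseteq> ?R"
  proof
    fix \<Psi> assume "\<Psi> \<in> rdag_model m E cv ce"
    then obtain \<Lambda> \<Omega> where Psi: "\<Psi> = concentration_mat m \<Lambda> \<Omega>"
      and L: "\<Lambda> \<in> carrier_mat m m" "\<forall>i<m. \<forall>j<m. (j, i) \<notin> E \<longrightarrow> \<Lambda> $$ (i, j) = 0"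
      and Lc: "\<forall>i j k l. (j, i) \<in> E \<longrightarrow> (l, k) \<in> E \<longrightarrow> ce i j = ce k l \<longrightarrow>
        \<Lambda> $$ (i, j) = \<Lambda> $$ (k, l)"
      and O: "\<Omega> \<in> carrier_mat m m" "diagonal_mat \<Omega>" "\<forall>i<m. \<Omega> $$ (i, i) > 0"
      and Oc: "\<forall>i<m. \<forall>j<m. cv i = cv j \<longrightarrow> \<Omega> $$ (i, i) = \<Omega> $$ (j, j)"
      unfolding rdag_model_def mem_Collect_eq by (elim exE conjE) (rule that)
    define lam where "lam (s :: 'a) t = \<Lambda> $$ (SOME ij. (snd ij, fst ij) \<in> E \<and> ce (fst ij) (snd ij) = t)"
      for s t
    define om where "om s = (let i = (SOME i. i < m \<and> cv i = s) in \<Omega> $$ (i, i))" for s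
    have lam: "lam s (ce i j) = \<Lambda> $$ (i, j)" if "(j, i) \<in> E" for s i j
    proof -
      let ?P = "\<lambda>kl. (snd kl, fst kl) \<in> E \<and> ce (fst kl) (snd kl) = ce i j"
      have "?P (SOME kl. ?P kl)" by (rule someI[of ?P "(i, j)"]) (use that in simp)
      then show ?thesis
        using Lc[rule_format, of "snd (SOME kl. ?P kl)" "fst (SOME kl. ?P kl)" j i] that
        by (simp add: lam_def)
    qed
    have om: "om (cv i) = \<Omega> $$ (i, i)" if "i < m" for i
    proof -
      have "(SOME k. k < m \<and> cv k = cv i) < m \<and> cv (SOME k. k < m \<and> cv k = cv i) = cv i"
        by (rule someI[of _ i]) (use that in simp)
      then show ?thesis unfolding om_def Let_def using that by (intro Oc[rule_format]) auto
    qed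
    have "\<Lambda> = coeff_mat m E cv ce lam"
      using L by (intro eq_matI) (auto simp: coeff_mat_def lam)
    moreover have "\<Omega> = variance_mat m cv om"
      using O(1,2) by (intro eq_matI) (auto simp: variance_mat_def mat_diag_def om diagonal_mat_def)
    ultimately show "\<Psi> \<in> ?R" using Psi O(3) by (auto simp: om intro!: exI[of _ lam] exI[of _ om])
  qed
  show "?R \<subseteq> rdag_model m E cv ce"
  proof
    fix \<Psi> assume "\<Psi> \<in> ?R"
    then obtain lam om where Psi: "\<Psi> = concentration_mat m (coeff_mat m E cv ce lam) (variance_mat m cv om)"
      and om: "\<forall>s \<in> cv ` {..<m}. om s > 0" by blast
    let ?L = "coeff_mat m E cv ce lam" and ?O = "variance_mat m cv om"
    have colours: "?L $$ (i, j) = ?L $$ (k, l)"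
      if "(j, i) \<in> E" "(l, k) \<in> E" "ce i j = ce k l" for i j k l
    proof -
      have "cv i = cv k" using comp that unfolding compatible_colouring_def by blast
      then show ?thesis using that Em[OF that(1)] Em[OF that(2)] by (simp add: coeff_mat_def)
    qed
    have supp: "?L \<in> carrier_mat m m" "\<forall>i<m. \<forall>j<m. (j, i) \<notin> E \<longrightarrow> ?L $$ (i, j) = 0"
      by (simp_all add: coeff_mat_def)
    have diag: "?O \<in> carrier_mat m m" "diagonal_mat ?O" "\<forall>i<m. ?O $$ (i, i) = om (cv i)"
      by (auto simp: variance_mat_def mat_diag_def diagonal_mat_def)
    have var: "\<forall>i<m. ?O $$ (i, i) > 0" "\<forall>i<m. \<forall>j<m. cv i = cv j \<longrightarrow> ?O $$ (i, i) = ?O $$ (j, j)"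
      using om diag(3) by auto
    show "\<Psi> \<in> rdag_model m E cv ce"
      unfolding rdag_model_def Psi mem_Collect_eq
      by (intro exI[of _ ?L] exI[of _ ?O] conjI) (use colours supp diag(1,2) var in blast)+
  qed
qed

lemma log_likelihood_rdag:
  assumes dag: "ordered_dag m E" and Y: "Y \<in> carrier_mat m n"
    and om: "\<forall>s \<in> cv ` {..<m}. om s > 0"
  shows "log_likelihood n Y (concentration_mat m (coeff_mat m E cv ce lam) (variance_mat m cv om)) =
    (\<Sum>s \<in> cv ` {..<m}. - (real (alpha m cv s) * ln (om s))
        - rss m n E cv ce Y s (lam s) / (real n * om s))"
proof -
  let ?L = "coeff_mat m E cv ce lam"
  have Em: "i < m" "j < m" "i < j" if "(j, i) \<in> E" for i j
    using dag that by (auto simp: ordered_dag_def)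
  have Lc: "?L \<in> carrier_mat m m" by (simp add: coeff_mat_def)
  define h where "h i = (\<Sum>q<n.
    (Y $$ (i, q) - (\<Sum>j | (j, i) \<in> E. lam (cv i) (ce i j) * Y $$ (j, q)))\<^sup>2)" for i
  have W: "((1\<^sub>m m - ?L) * Y) $$ (i, q) =
      Y $$ (i, q) - (\<Sum>j | (j, i) \<in> E. lam (cv i) (ce i j) * Y $$ (j, q))"
    if "i < m" "q < n" for i q
  proof -
    have "((1\<^sub>m m - ?L) * Y) $$ (i, q) = Y $$ (i, q) - (?L * Y) $$ (i, q)"
      using that Lc Y by (simp add: minus_mult_distrib_mat[of _ m m _ _ n])
    also have "(?L * Y) $$ (i, q) =
        (\<Sum>j<m. if (j, i) \<in> E then lam (cv i) (ce i j) * Y $$ (j, q) else 0)"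
      using that Lc Y
      by (auto simp: scalar_prod_def atLeast0LessThan coeff_mat_def intro!: sum.cong)
    also have "\<dots> = (\<Sum>j | (j, i) \<in> E. lam (cv i) (ce i j) * Y $$ (j, q))"
      using Em by (intro sum.mono_neutral_cong_right) auto
    finally show ?thesis .
  qed
  have "log_likelihood n Y (concentration_mat m ?L (variance_mat m cv om)) =
      (\<Sum>i<m. - ln (om (cv i)) - h i / (real n * om (cv i)))"
    unfolding variance_mat_def
  proof (subst log_likelihood_unitriangular[OF Lc _ _ Y])
    show "?L $$ (i, j) = 0" if "i < m" "j \<le> i" for i j
      using that Em[of j i] by (auto simp: coeff_mat_def)
  qed (use om in \<open>auto simp: W h_def\<close>)
  also have "\<dots> = (\<Sum>s \<in> cv ` {..<m}. \<Sum>i | i \<in> {..<m} \<and> cv i = s.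
      - ln (om (cv i)) - h i / (real n * om (cv i)))"
    by (rule sum.image_gen) simp
  also have "\<dots> = (\<Sum>s \<in> cv ` {..<m}. - (real (alpha m cv s) * ln (om s))
        - rss m n E cv ce Y s (lam s) / (real n * om s))"
  proof (rule sum.cong[OF refl])
    fix s
    have "(\<Sum>i | i \<in> {..<m} \<and> cv i = s. - ln (om (cv i)) - h i / (real n * om (cv i)))
        = (\<Sum>i | i < m \<and> cv i = s. - ln (om s) - h i / (real n * om s))"
      by (intro sum.cong) auto
    also have "\<dots> = - (real (alpha m cv s) * ln (om s)) - (\<Sum>i | i < m \<and> cv i = s. h i) / (real n * om s)"
      by (simp add: sum_subtractf alpha_def sum_divide_distrib)
    also have "(\<Sum>i | i < m \<and> cv i = s. h i) = rss m n E cv ce Y s (lam s)"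
      unfolding rss_def h_def by (intro sum.cong) auto
    finally show "(\<Sum>i | i \<in> {..<m} \<and> cv i = s. - ln (om (cv i)) - h i / (real n * om (cv i)))
      = - (real (alpha m cv s) * ln (om s)) - rss m n E cv ce Y s (lam s) / (real n * om s)" .
  qed
  finally show ?thesis .
qed

section \<open>Maximising the summand of one colour\<close>

text \<open>
  The right-hand side is the value of the left-hand side at \<open>w = w0\<close> and \<open>q = a * n * w0\<close>.
\<close>

lemma gaussian_summand_le:
  fixes a n w w0 q :: real
  assumes "a > 0" "n > 0" "w > 0" "w0 > 0" and q: "a * n * w0 \<le> q"
  shows "- (a * ln w) - q / (n * w) \<le> - (a * ln w0) - a"
proof -
  have "a * w0 / w = a * n * w0 / (n * w)" using assms by simp
  also have "\<dots> \<le> q / (n * w)" using assms by (intro divide_right_mono) auto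
  finally have "a * w0 / w \<le> q / (n * w)" .
  moreover have "ln (w0 / w) \<le> w0 / w - 1" using assms by (intro ln_le_minus_one) auto
  then have "a * (ln w0 - ln w) \<le> a * (w0 / w - 1)" using assms by (simp add: ln_div)
  ultimately show ?thesis by (simp add: algebra_simps)
qed

lemma proj_top_is_orth_proj:
  assumes "finite E"
  shows "is_orth_proj (alpha m cv s * n) (aug_row m n E cv ce Y s ` prc E cv ce s)
           (aug_top m n cv Y s) (proj_top m n E cv ce Y s)"
  unfolding proj_top_def
  by (rule orth_proj_is_orth_proj)
    (rule finite_imageI[OF finite_prc[OF assms]], auto simp: aug_row_def aug_top_def)

theorem mainTheorem8:
  fixes m n :: nat
    and E :: "(nat \<times> nat) set"
    and cv :: "nat \<Rightarrow> 'c"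
    and ce :: "nat \<Rightarrow> nat \<Rightarrow> 'c"
    and Y :: "real mat"
  assumes "ordered_dag m E"
    and "compatible_colouring m E cv ce"
    and "n \<ge> 1"
    and "Y \<in> carrier_mat m n"
  shows "((\<exists>s \<in> cv ` {..<m}. proj_top m n E cv ce Y s = aug_top m n cv Y s) \<longrightarrow>
            \<not> (\<exists>\<Psi>. is_MLE m n E cv ce Y \<Psi>)) \<and>
         ((\<forall>s \<in> cv ` {..<m}. proj_top m n E cv ce Y s \<noteq> aug_top m n cv Y s) \<longrightarrow>
            (\<forall>lam :: 'c \<Rightarrow> 'c \<Rightarrow> real.
               (\<forall>s \<in> cv ` {..<m}.
                  proj_top m n E cv ce Y s =
                    finsum_vec TYPE(real) (alpha m cv s * n)
                      (\<lambda>t. lam s t \<cdot>\<^sub>v aug_row m n E cv ce Y s t) (prc E cv ce s)) \<longrightarrow>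
               is_MLE m n E cv ce Y
                 (concentration_mat m (coeff_mat m E cv ce lam)
                   (variance_mat m cv (omega_hat m n E cv ce Y)))))"
proof -
  let ?C = "cv ` {..<m}"
  let ?a = "\<lambda>s. real (alpha m cv s)"
  let ?rss = "rss m n E cv ce Y"
  let ?comb = "\<lambda>s c. finsum_vec TYPE(real) (alpha m cv s * n)
                 (\<lambda>t. c t \<cdot>\<^sub>v aug_row m n E cv ce Y s t) (prc E cv ce s)"
  let ?Psi = "\<lambda>lam om. concentration_mat m (coeff_mat m E cv ce lam) (variance_mat m cv om)"
  have fE: "finite E"
    using assms(1) finite_subset[of E "{..<m} \<times> {..<m}"] by (simp add: ordered_dag_def)
  note ll = log_likelihood_rdag[OF assms(1,4)]
  note model = rdag_model_parametrisation[OF assms(1,2)]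
  have a_pos: "?a s > 0" if "s \<in> ?C" for s
    using that by (auto simp: alpha_def card_gt_0_iff)
  have n_pos: "real n > 0" using assms(3) by simp
  have span: "vec_span (alpha m cv s * n) (aug_row m n E cv ce Y s ` prc E cv ce s)
      = range (?comb s)" for s
    by (rule vec_span_image) (use finite_prc[OF fE] in \<open>auto simp: aug_row_def\<close>)
  have proj_span: "proj_top m n E cv ce Y s \<in> range (?comb s)" for s
    using proj_top_is_orth_proj[OF fE, of m cv s n ce Y] unfolding is_orth_proj_def span by blast
  show ?thesis
  proof (intro conjI impI allI notI)
    assume "\<exists>s \<in> ?C. proj_top m n E cv ce Y s = aug_top m n cv Y s"
    then obtain s where s: "s \<in> ?C" and eq: "proj_top m n E cv ce Y s = aug_top m n cv Y s" by blast
    obtain c where c: "aug_top m n cv Y s = ?comb s c" using proj_span[of s] eq by auto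
    have rss0: "?rss s c = 0"
      using norm_residual_eq_rss[OF fE refl, of m cv s n c ce Y] unfolding c[symmetric]
      by (simp add: scalar_prod_def)
    assume "\<exists>\<Psi>. is_MLE m n E cv ce Y \<Psi>"
    then obtain lam om where om: "\<forall>s \<in> ?C. om s > 0"
      and mle: "is_MLE m n E cv ce Y (?Psi lam om)"
      unfolding is_MLE_def model by blast
    \<comment> \<open>A residual of zero for colour \<open>s\<close> leaves the term \<open>- \<alpha>\<^sub>s ln \<omega>\<^sub>s\<close>, which has no maximum.\<close>
    define lam' om' where "lam' = lam(s := c)" and "om' = om(s := om s / 2)"
    have om': "\<forall>s \<in> ?C. om' s > 0" using om by (auto simp: om'_def)
    let ?f = "\<lambda>lam om s. - (?a s * ln (om s)) - ?rss s (lam s) / (real n * om s)"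
    have "om s > 0" using om s by blast
    then have "ln (om s / 2) < ln (om s)" by simp
    then have "?a s * ln (om s / 2) < ?a s * ln (om s)" using a_pos[OF s] by simp
    moreover have "0 \<le> ?rss s (lam s) / (real n * om s)"
      using rss_nonneg om s by (intro divide_nonneg_nonneg) (auto simp: less_imp_le)
    ultimately have "?f lam om s < ?f lam' om' s" by (simp add: lam'_def om'_def rss0)
    then have "(\<Sum>s\<in>?C. ?f lam om s) < (\<Sum>s\<in>?C. ?f lam' om' s)"
      using s by (intro sum_strict_mono_ex1) (auto simp: lam'_def om'_def)
    moreover have "log_likelihood n Y (?Psi lam' om') \<le> log_likelihood n Y (?Psi lam om)"
      using mle om' unfolding is_MLE_def model by blast
    ultimately show False by (simp add: ll[OF om] ll[OF om'])
  next
    fix lam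
    assume neq: "\<forall>s \<in> ?C. proj_top m n E cv ce Y s \<noteq> aug_top m n cv Y s"
      and lam: "\<forall>s \<in> ?C. proj_top m n E cv ce Y s = ?comb s (lam s)"
    let ?om = "omega_hat m n E cv ce Y"
    have om_eq: "?a s * real n * ?om s = ?rss s (lam s)" if s: "s \<in> ?C" for s
      unfolding norm_residual_eq_rss[OF fE refl, of m cv s n "lam s" ce Y, symmetric]
      using bspec[OF lam s] a_pos[OF s] n_pos by (simp add: omega_hat_def Let_def)
    have rss_min: "?rss s (lam s) \<le> ?rss s c" if s: "s \<in> ?C" for s c
    proof -
      have "aug_row m n E cv ce Y s ` prc E cv ce s \<subseteq> carrier_vec (alpha m cv s * n)"
        and "aug_top m n cv Y s \<in> carrier_vec (alpha m cv s * n)"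
        by (auto simp: aug_row_def aug_top_def)
      from orth_proj_minimises_distance[OF this proj_top_is_orth_proj[OF fE], of "?comb s c"]
      show ?thesis
        unfolding span bspec[OF lam s]
        by (simp add: norm_residual_eq_rss[OF fE refl])
    qed
    have om: "\<forall>s \<in> ?C. ?om s > 0"
    proof
      fix s assume s: "s \<in> ?C"
      let ?r = "proj_top m n E cv ce Y s - aug_top m n cv Y s"
      have "dim_vec (proj_top m n E cv ce Y s) = dim_vec (aug_top m n cv Y s)"
        using lam s finsum_vec_closed[of "\<lambda>t. lam s t \<cdot>\<^sub>v aug_row m n E cv ce Y s t"
            "prc E cv ce s" "alpha m cv s * n"] by (auto simp: aug_row_def aug_top_def)
      then have "?r \<bullet> ?r > 0" using neq s by (intro scalar_prod_diff_self_pos) auto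
      then show "?om s > 0" using a_pos[OF s] n_pos by (simp add: omega_hat_def Let_def)
    qed
    show "is_MLE m n E cv ce Y (?Psi lam ?om)"
      unfolding is_MLE_def
    proof (intro conjI ballI)
      show "?Psi lam ?om \<in> rdag_model m E cv ce" using om unfolding model by blast
      fix \<Psi>' assume "\<Psi>' \<in> rdag_model m E cv ce"
      then obtain lam' om' where Psi': "\<Psi>' = ?Psi lam' om'" and om': "\<forall>s \<in> ?C. om' s > 0"
        unfolding model by blast
      have "- (?a s * ln (om' s)) - ?rss s (lam' s) / (real n * om' s)
          \<le> - (?a s * ln (?om s)) - ?rss s (lam s) / (real n * ?om s)" if s: "s \<in> ?C" for s
      proof -
        have "?rss s (lam s) / (real n * ?om s) = ?a s"
          using om_eq[OF s] bspec[OF om s] n_pos by (simp add: field_simps)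
        then show ?thesis
          using gaussian_summand_le[OF a_pos[OF s] n_pos, of "om' s" "?om s" "?rss s (lam' s)"]
            om om' s om_eq[OF s] rss_min[OF s, of "lam' s"] by simp
      qed
      then show "log_likelihood n Y \<Psi>' \<le> log_likelihood n Y (?Psi lam ?om)"
        unfolding Psi' ll[OF om] ll[OF om'] by (rule sum_mono)
    qed
  qed
qed

end
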